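(* Let left and right states $(h_\ell,u_\ell)$ and $(h_r,u_r)$ of the shallow water Riemann problem be given, with $h_\ell,h_r>0$ and $u_\ell,u_r\in\mathbb{R}$, let $\phi$ be the associated depth function, with $\phi(0)\le 0$, and let $h_*\ge 0$ be its unique real root. Consider Newton's method applied to $\phi$, $$h^{[k+1]}=h^{[k]}-\frac{\phi(h^{[k]})}{\phi'(h^{[k]})},\qquad k\ge 0.$$ If the initial guess satisfies $0\le h^{[0]}\le h_*$, then the iteration converges to $h_*$.
   Context: Let $g>0$ be the gravitational constant. For $h\ge 0$ the depth function is $\phi(h)=f(h;h_\ell)+f(h;h_r)+u_r-u_\ell$, where, for $s\in\{\ell,r\}$, $$f(h;h_s)=\begin{cases}2\left(\sqrt{gh}-\sqrt{gh_s}\right) & \text{if } h\le h_s,\\[4pt] (h-h_s)\sqrt{\tfrac12 g\,\dfrac{h+h_s}{h\,h_s}} & \text{if } h>h_s.\end{cases}$$ For $h>0$ one has $\phi'(h)>0$ and $\phi''(h)<0$, and $\phi(h)\to+\infty$ as $h\to\infty$. Together with $\phi(0)\le 0$, i.e. $u_r-u_\ell\le 2\sqrt{gh_\ell}+2\sqrt{gh_r}$, this gives a unique root $h_*$, which is the depth of the intermediate state in the Riemann solution. In the case $h_*=0$ the hypothesis forces $h^{[0]}=h_*=0$, so the initial guess is already the root.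
   Formalization: The initial guess 0 with a positive root is in effect excluded: there the derivative of the depth function is infinite and Newton's formula is undefined; the iteration exists and converges for a positive guess or when the root is 0, where it is taken to stay at the root. *)

theory Defs
  imports "HOL-Analysis.Analysis"
begin

definition depth_part :: "real \<Rightarrow> real \<Rightarrow> real \<Rightarrow> real" where
  "depth_part g hs h =
     (if h \<le> hs then 2 * (sqrt (g * h) - sqrt (g * hs))
      else (h - hs) * sqrt (1/2 * g * ((h + hs) / (h * hs))))"

text \<open>The depth function is meant on \<open>{0..}\<close> only; its values at negative depths play no role.\<close>

definition depth_fun :: "real \<Rightarrow> real \<Rightarrow> real \<Rightarrow> real \<Rightarrow> real \<Rightarrow> real \<Rightarrow> real" where
  "depth_fun g hl ul hr ur h = depth_part g hl h + depth_part g hr h + ur - ul"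

definition star_depth :: "real \<Rightarrow> real \<Rightarrow> real \<Rightarrow> real \<Rightarrow> real \<Rightarrow> real" where
  "star_depth g hl ul hr ur = (THE h. 0 \<le> h \<and> depth_fun g hl ul hr ur h = 0)"

text \<open>
  A Newton step from \<open>x\<close> requires a finite nonzero derivative at \<open>x\<close>, relative to the domain
  \<open>S\<close> of the function; at a root the iteration is stationary, whether or not the derivative
  exists. The second clause matters for the depth function at \<open>0\<close>, where the one-sided
  derivative is infinite: if \<open>0\<close> is the root, the iteration stays there; if \<open>0\<close> is not
  the root, no step is defined. Total division and \<open>deriv\<close> would instead assign a junk value
  to that step.
\<close>

definition newton_step_on :: "real set \<Rightarrow> (real \<Rightarrow> real) \<Rightarrow> real \<Rightarrow> real \<Rightarrow> bool" where
  "newton_step_on S f x y \<longleftrightarrow>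
     (\<exists>D. (f has_real_derivative D) (at x within S) \<and> D \<noteq> 0 \<and> y = x - f x / D) \<or>
     (f x = 0 \<and> y = x)"

definition newton_iteration_on ::
    "real set \<Rightarrow> (real \<Rightarrow> real) \<Rightarrow> real \<Rightarrow> (nat \<Rightarrow> real) \<Rightarrow> bool" where
  "newton_iteration_on S f x0 x \<longleftrightarrow>
     x 0 = x0 \<and> (\<forall>k. x k \<in> S \<and> newton_step_on S f (x k) (x (Suc k)))"

end

theory Submission
  imports Defs
begin

text \<open>
  The depth function is concave on \<open>{0..}\<close>: the two branches of each part meet with
  equal slopes, and these slopes decrease. Newton's method for a concave function started to the
  left of the root \<open>r\<close> never overshoots, because tangents lie above the graph, and it
  moves to the right. The derivatives along the way are at most the first one, \<open>D\<^sub>0\<close>, so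
  \<open>- f (x\<^sub>k) \<le> D\<^sub>0 (x\<^sub>k\<^sub>+\<^sub>1 - x\<^sub>k)\<close>, and the limit of the iterates is a root. At \<open>0\<close> this
  argument never needs that the one-sided derivative is infinite.
\<close>

section \<open>Newton's method for a concave function on an interval\<close>

lemma concave_on_below_tangent:
  fixes f :: "real \<Rightarrow> real"
  assumes f: "concave_on S f" and x: "x \<in> S" and y: "y \<in> S"
    and D: "(f has_real_derivative D) (at x within S)"
  shows "f y \<le> f x + D * (y - x)"
proof -
  \<comment> \<open>Restricting to the segment from \<open>x\<close> to \<open>y\<close> works even
    when \<open>x\<close> is an endpoint of \<open>S\<close>, where the derivative is only
    one-sided. Concavity bounds every difference quotient at \<open>x\<close> below by
    \<open>f y - f x\<close>, and the limit inherits the bound.\<close>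
  let ?p = "\<lambda>t. x + t * (y - x)"
  have p_eq: "?p t = (1 - t) *\<^sub>R x + t *\<^sub>R y" for t
    by (simp add: algebra_simps)
  have pS: "?p ` {0..1} \<subseteq> S"
    using concave_on_imp_convex[OF f] x y unfolding convex_alt p_eq by auto
  have "(f has_real_derivative D) (at (?p 0) within ?p ` {0..1})"
    using DERIV_subset[OF D pS] by simp
  moreover have "(?p has_real_derivative y - x) (at 0 within {0..1})"
    by (auto intro!: derivative_eq_intros)
  ultimately have "(f \<circ> ?p has_real_derivative D * (y - x)) (at 0 within {0..1})"
    by (rule DERIV_image_chain)
  then have lim: "((\<lambda>t. (f (?p t) - f x) / t) \<longlongrightarrow> D * (y - x)) (at 0 within {0..1})"
    by (simp add: has_field_derivative_iff o_def)
  have "f y - f x \<le> (f (?p t) - f x) / t" if "0 < t" "t \<le> 1" for t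
    using concave_onD[OF f, of t x y] that x y unfolding p_eq[symmetric]
    by (simp add: field_simps)
  then have "\<forall>\<^sub>F t in at 0 within {0..1}. f y - f x \<le> (f (?p t) - f x) / t"
    by (auto simp: eventually_at_filter)
  then have "f y - f x \<le> D * (y - x)"
    by (intro tendsto_lowerbound[OF lim]) (auto simp: trivial_limit_within islimpt_Icc)
  then show ?thesis by simp
qed

text \<open>The tangent at \<open>x < r\<close> is negative at \<open>x\<close> and, lying above the
  graph, nonnegative at \<open>r\<close>. Hence its slope is positive and its zero lies between
  \<open>x\<close> and \<open>r\<close>.\<close>

lemma newton_step_on_concave:
  assumes f: "concave_on S f" and r: "r \<in> S" "f r = 0"
    and neg: "\<And>x. x \<in> S \<Longrightarrow> x < r \<Longrightarrow> f x < 0"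
    and step: "newton_step_on S f x y" and x: "x \<in> S" "x \<le> r"
  shows "x \<le> y" and "y \<le> r"
proof -
  have "x \<le> y \<and> y \<le> r"
  proof (cases "x = r")
    case True
    then show ?thesis using step r by (auto simp: newton_step_on_def)
  next
    case False
    then have lt: "x < r" and fx: "f x < 0" using x neg by auto
    then obtain D where D: "(f has_real_derivative D) (at x within S)"
      and y: "y = x - f x / D"
      using step by (auto simp: newton_step_on_def)
    have tan: "0 \<le> f x + D * (r - x)"
      using concave_on_below_tangent[OF f x(1) r(1) D] r by simp
    then have "0 < D * (r - x)" using fx by linarith
    then have "0 < D" using lt by (simp add: zero_less_mult_iff)
    then show ?thesis using tan fx by (simp add: y field_simps)
  qed
  then show "x \<le> y" "y \<le> r" by auto
qed

lemma newton_iteration_on_concave: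
  assumes f: "concave_on S f" and r: "r \<in> S" "f r = 0"
    and neg: "\<And>x. x \<in> S \<Longrightarrow> x < r \<Longrightarrow> f x < 0"
    and iter: "newton_iteration_on S f x0 x" and x0: "x0 \<le> r"
  shows "x k \<le> r" and "x k \<le> x (Suc k)" and "incseq x"
proof -
  have xS: "x k \<in> S" and step: "newton_step_on S f (x k) (x (Suc k))" for k
    using iter by (auto simp: newton_iteration_on_def)
  show le: "x k \<le> r" for k
  proof (induction k)
    case 0
    then show ?case using iter x0 by (simp add: newton_iteration_on_def)
  next
    case (Suc k)
    then show ?case using newton_step_on_concave(2)[OF f r neg step xS] by simp
  qed
  show "x k \<le> x (Suc k)" for k
    by (rule newton_step_on_concave(1)[OF f r neg step xS le])
  then show "incseq x" by (rule incseq_SucI)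
qed

lemma newton_concave_converges:
  assumes f: "concave_on S f" and cont: "continuous_on S f"
    and r: "r \<in> S" "f r = 0"
    and neg: "\<And>x. x \<in> S \<Longrightarrow> x < r \<Longrightarrow> f x < 0"
    and iter: "newton_iteration_on S f x0 x" and x0: "x0 \<le> r"
  shows "x \<longlonglongrightarrow> r"
proof -
  have xS: "x k \<in> S" and step: "newton_step_on S f (x k) (x (Suc k))" for k
    using iter by (auto simp: newton_iteration_on_def)
  note le = newton_iteration_on_concave(1)[OF f r neg iter x0]
  note Suc_ge = newton_iteration_on_concave(2)[OF f r neg iter x0]
  note inc = newton_iteration_on_concave(3)[OF f r neg iter x0]
  have ge: "x 0 \<le> x k" for k using inc by (simp add: incseq_def)
  show ?thesis
  proof (cases "x 0 = r")
    case True
    then have "x k = r" for k using le ge by (metis antisym)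
    then have "x = (\<lambda>k. r)" by auto
    then show ?thesis by simp
  next
    case False
    then have "f (x 0) < 0" using neg[OF xS] le[of 0] by simp
    then obtain D0 where D0: "(f has_real_derivative D0) (at (x 0) within S)"
      and x1: "x 1 = x 0 - f (x 0) / D0" "D0 \<noteq> 0"
      using step[of 0] by (auto simp: newton_step_on_def)
    have "0 \<le> f (x 0) + D0 * (r - x 0)"
      using concave_on_below_tangent[OF f xS r(1) D0] r by simp
    then have "0 < D0 * (r - x 0)" using \<open>f (x 0) < 0\<close> by linarith
    then have "0 < D0" using le[of 0] by (simp add: zero_less_mult_iff)
    \<comment> \<open>Strictness of the first step keeps \<open>x k - x 0\<close> positive for all
      \<open>k > 0\<close>, so that it can be cancelled when slopes are compared.\<close>
    then have "x 0 < x 1" using \<open>f (x 0) < 0\<close> x1 by (simp add: divide_neg_pos)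
    have slope: "- f (x k) \<le> D0 * (x (Suc k) - x k)" for k
    proof (cases "k = 0 \<or> f (x k) = 0")
      case True
      then show ?thesis using Suc_ge[of k] x1 \<open>0 < D0\<close> by auto
    next
      case False
      then obtain D where D: "(f has_real_derivative D) (at (x k) within S)"
        and y: "x (Suc k) = x k - f (x k) / D" "D \<noteq> 0"
        using step[of k] by (auto simp: newton_step_on_def)
      have lt: "0 < x k - x 0" using False \<open>x 0 < x 1\<close> incseqD[OF inc, of 1 k] by auto
      \<comment> \<open>Sum of two tangent inequalities: the tangent at \<open>x k\<close> evaluated
        at \<open>x 0\<close>, and the tangent at \<open>x 0\<close> evaluated at
        \<open>x k\<close>.\<close>
      have "D * (x k - x 0) \<le> D0 * (x k - x 0)"
        using concave_on_below_tangent[OF f xS[of k] xS[of 0] D]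
          concave_on_below_tangent[OF f xS[of 0] xS[of k] D0]
        by (simp add: algebra_simps)
      then have "D \<le> D0" using lt by simp
      then have "D * (x (Suc k) - x k) \<le> D0 * (x (Suc k) - x k)"
        using Suc_ge[of k] by (intro mult_right_mono) auto
      then show ?thesis using y by simp
    qed
    obtain L where L: "x \<longlonglongrightarrow> L" "\<forall>i. x i \<le> L"
      using incseq_convergent[OF inc, of r] le by auto
    have Lr: "L \<le> r" using L(1) le by (intro LIMSEQ_le_const2) auto
    have LS: "L \<in> S"
      using mem_is_interval_1_I[of S "x 0" r L] xS r Lr L(2)
        concave_on_imp_convex[OF f] by (auto simp: is_interval_convex_1)
    have lim: "(\<lambda>k. f (x k)) \<longlonglongrightarrow> f L"
      using continuous_on_tendsto_compose[OF cont L(1) LS] xS by simp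
    have "(\<lambda>k. D0 * (x (Suc k) - x k)) \<longlonglongrightarrow> D0 * (L - L)"
      by (intro tendsto_intros LIMSEQ_Suc L(1))
    \<comment> \<open>The right side is zero, so \<open>f L\<close> is nonnegative, which
      \<open>neg\<close> rules out for \<open>L < r\<close>.\<close>
    then have "- f L \<le> D0 * (L - L)"
      by (rule LIMSEQ_le[OF tendsto_minus[OF lim]]) (use slope in auto)
    then have "L = r" using neg[OF LS] Lr by force
    then show ?thesis using L by simp
  qed
qed

text \<open>Derivatives are required only strictly to the left of \<open>r\<close>: once
  \<open>r\<close> is reached, the stationary clause of \<open>newton_step_on\<close> continues the
  sequence.\<close>

lemma newton_concave_exists:
  assumes f: "concave_on S f" and r: "r \<in> S" "f r = 0"
    and neg: "\<And>x. x \<in> S \<Longrightarrow> x < r \<Longrightarrow> f x < 0"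
    and diff: "\<And>x. x0 \<le> x \<Longrightarrow> x < r \<Longrightarrow> \<exists>D. (f has_real_derivative D) (at x within S)"
    and x0: "x0 \<in> S" "x0 \<le> r"
  shows "\<exists>x. newton_iteration_on S f x0 x"
proof -
  have step: "\<exists>y. newton_step_on S f x y" if "x0 \<le> x" "x \<le> r" "x \<in> S" for x
  proof (cases "x = r")
    case True
    then show ?thesis using r by (auto simp: newton_step_on_def)
  next
    case False
    then have lt: "x < r" using that by simp
    obtain D where D: "(f has_real_derivative D) (at x within S)"
      using diff \<open>x0 \<le> x\<close> lt by blast
    have "0 \<le> f x + D * (r - x)"
      using concave_on_below_tangent[OF f that(3) r(1) D] r by simp
    then have "D \<noteq> 0" using neg[OF that(3) lt] by auto
    then show ?thesis using D by (auto simp: newton_step_on_def)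
  qed
  \<comment> \<open>The choice principle does not prescribe the first term; the conjunct on
    \<open>k = 0\<close> pins it to \<open>x0\<close>. The other conjuncts keep the iterates where a
    step exists.\<close>
  have "\<exists>x. \<forall>k. ((x0 \<le> x k \<and> x k \<le> r \<and> x k \<in> S) \<and> (k = 0 \<longrightarrow> x k = x0)) \<and>
      newton_step_on S f (x k) (x (Suc k)) "
  proof (rule dependent_nat_choice)
    show "\<exists>x. (x0 \<le> x \<and> x \<le> r \<and> x \<in> S) \<and> ((0::nat) = 0 \<longrightarrow> x = x0)"
      using x0 by auto
  next
    fix x and k :: nat
    assume "(x0 \<le> x \<and> x \<le> r \<and> x \<in> S) \<and> (k = 0 \<longrightarrow> x = x0)"
    then have x: "x0 \<le> x" "x \<le> r" "x \<in> S" by auto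
    obtain y where y: "newton_step_on S f x y" using step[OF x] by auto
    have xy: "x \<le> y" "y \<le> r"
      using newton_step_on_concave[OF f r neg y x(3) x(2)] by auto
    moreover have "y \<in> S"
      using mem_is_interval_1_I[of S x r y] xy x r concave_on_imp_convex[OF f]
      by (auto simp: is_interval_convex_1)
    ultimately show "\<exists>y. ((x0 \<le> y \<and> y \<le> r \<and> y \<in> S) \<and> (Suc k = 0 \<longrightarrow> y = x0)) \<and>
      newton_step_on S f x y"
      using x y by (intro exI[of _ y]) auto
  qed
  then show ?thesis by (auto simp: newton_iteration_on_def)
qed


section \<open>Concavity on a closed half-line from a decreasing derivative in its interior\<close>

lemma concave_on_atLeast:
  fixes f f' :: "real \<Rightarrow> real"
  assumes cont: "continuous_on {a..} f"
    and der: "\<And>x. a < x \<Longrightarrow> (f has_real_derivative f' x) (at x)"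
    and anti: "\<And>x y. a < x \<Longrightarrow> x \<le> y \<Longrightarrow> f' y \<le> f' x"
  shows "concave_on {a..} f"
proof (rule concave_on_linorderI)
  have mean_value: "\<exists>w. u < w \<and> w < v \<and> f v - f u = f' w * (v - u)"
    if uv: "a \<le> u" "u < v" for u v
  proof -
    have "continuous_on {u..v} f"
      by (rule continuous_on_subset[OF cont]) (use uv in auto)
    moreover have "(f has_derivative (*) (f' w)) (at w)" if "u < w" for w
      using der[of w] that uv by (simp add: has_field_derivative_def)
    ultimately obtain w where "u < w" "w < v" "f v - f u = f' w * (v - u)"
      using mvt[OF uv(2), of f "\<lambda>w. (*) (f' w)"] by blast
    then show ?thesis by blast
  qed
  \<comment> \<open>The point of tangency \<open>z\<close> is interior, but \<open>y\<close> may be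
    the endpoint \<open>a\<close>: the mean value theorem needs only continuity there. This admits
    an infinite slope at \<open>a\<close>.\<close>
  have tan: "f y \<le> f z + f' z * (y - z)" if zy: "a < z" "a \<le> y" for y z
  proof (cases y z rule: linorder_cases)
    case less
    then obtain w where w: "y < w" "w < z" "f z - f y = f' w * (z - y)"
      using mean_value[of y z] zy by auto
    have "f' z * (z - y) \<le> f' w * (z - y)"
      using w zy by (intro mult_right_mono anti) auto
    then show ?thesis using w by (simp add: algebra_simps)
  next
    case greater
    then obtain w where w: "z < w" "w < y" "f y - f z = f' w * (y - z)"
      using mean_value[of z y] zy by auto
    have "f' w * (y - z) \<le> f' z * (y - z)"
      using w zy by (intro mult_right_mono anti) auto
    then show ?thesis using w by (simp add: algebra_simps)
  qed simp
  fix t x y :: real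
  assume t: "0 < t" "t < 1" and xy: "x \<in> {a..}" "y \<in> {a..}" "x < y"
  define z where "z = (1 - t) * x + t * y"
  have "z - x = t * (y - x)" by (simp add: z_def algebra_simps)
  moreover have "0 < t * (y - x)" using t xy by simp
  ultimately have "a < z" using xy by simp
  \<comment> \<open>Average the tangent bounds at \<open>z\<close> with weights \<open>1 - t\<close>
    and \<open>t\<close>; the linear terms cancel because \<open>z\<close> is the weighted mean of
    \<open>x\<close> and \<open>y\<close>.\<close>
  have "(1 - t) * f x + t * f y
      \<le> (1 - t) * (f z + f' z * (x - z)) + t * (f z + f' z * (y - z))"
    using tan[OF \<open>a < z\<close>] t xy by (intro add_mono mult_left_mono) auto
  also have "\<dots> = f z" by (simp add: z_def algebra_simps)
  finally show "(1 - t) * f x + t * f y \<le> f ((1 - t) *\<^sub>R x + t *\<^sub>R y)"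
    by (simp add: z_def)
qed simp

section \<open>Slopes of the rarefaction and shock branches\<close>

text \<open>
  The slope of the shock branch in the variables \<open>a = 1 / hs\<close> and
  \<open>u = sqrt (1 / h + 1 / hs)\<close>, in which its monotonicity is a polynomial inequality.
\<close>
definition shock_slope :: "real \<Rightarrow> real \<Rightarrow> real \<Rightarrow> real" where
  "shock_slope g a u = sqrt (g/2) / (2 * a) * (u^3 - a * u + 2 * a\<^sup>2 / u)"

lemma shock_slope_mono:
  assumes "0 < g" "0 < a" "0 < u" "a \<le> u\<^sup>2" "u \<le> v"
  shows "shock_slope g a u \<le> shock_slope g a v"
proof -
  have v: "0 < v" using assms by simp
  have "u * u \<le> u * v" "u * u \<le> v * v" using assms by (auto intro: mult_mono)
  then have uv: "a \<le> u * v" "a \<le> v * v" using assms(4) by (auto simp: power2_eq_square)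
  then have "a * a \<le> a * (u * v)" using assms by (intro mult_left_mono) auto
  then have "2 * a\<^sup>2 / (u * v) \<le> 2 * a"
    using assms v by (simp add: field_simps power2_eq_square)
  \<comment> \<open>This is the difference of the brackets in \<open>shock_slope\<close>, factored.
    Since \<open>u * v\<close> and \<open>v\<^sup>2\<close> are at least \<open>a\<close>, the
    second factor is at least \<open>v\<^sup>2 + u * v + u\<^sup>2 - 3 * a\<close>, hence
    nonnegative.\<close>
  then have "0 \<le> (v - u) * (v\<^sup>2 + u * v + u\<^sup>2 - a - 2 * a\<^sup>2 / (u * v))"
    using uv assms by (intro mult_nonneg_nonneg) (auto simp: power2_eq_square)
  also have "\<dots> = (v^3 - a * v + 2 * a\<^sup>2 / v) - (u^3 - a * u + 2 * a\<^sup>2 / u)"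
    using assms v by (simp add: field_simps power2_eq_square power3_eq_cube)
  finally show ?thesis
    unfolding shock_slope_def using assms by (intro mult_left_mono) auto
qed

definition depth_part_slope :: "real \<Rightarrow> real \<Rightarrow> real \<Rightarrow> real" where
  "depth_part_slope g hs h =
     (if h \<le> hs then sqrt (g / h) else shock_slope g (1 / hs) (sqrt (1 / h + 1 / hs)))"

text \<open>The two branches meet with equal slopes, which gives differentiability at
  \<open>hs\<close> and monotonicity of the slope across it. At this depth
  \<open>u\<^sup>2 = 2 * a\<close>, and the bracket in \<open>shock_slope\<close> collapses to
  \<open>2 * a * u\<close>.\<close>

lemma shock_slope_at_hs:
  assumes "0 < g" "0 < hs"
  shows "shock_slope g (1 / hs) (sqrt (1 / hs + 1 / hs)) = sqrt (g / hs)"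
proof -
  define a where "a = 1 / hs"
  define u where "u = sqrt (2 * a)"
  have a: "0 < a" and u: "0 < u" "u * u = 2 * a" using assms by (auto simp: a_def u_def)
  have "u^3 - a * u + 2 * a\<^sup>2 / u = 2 * a * u"
    using u a by (simp add: field_simps power2_eq_square power3_eq_cube)
  then have "shock_slope g a u = sqrt (g / 2) / (2 * a) * (2 * a * u)"
    by (simp only: shock_slope_def)
  also have "\<dots> = sqrt (g / 2) * u" using a by simp
  also have "\<dots> = sqrt (g / hs)"
    unfolding u_def real_sqrt_mult[symmetric] by (simp add: a_def)
  finally show ?thesis by (simp add: a_def u_def)
qed

lemma depth_part_slope_antimono:
  assumes "0 < g" "0 < hs" "0 < h" "h \<le> k"
  shows "depth_part_slope g hs k \<le> depth_part_slope g hs h"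
proof -
  let ?s = "\<lambda>h. shock_slope g (1 / hs) (sqrt (1 / h + 1 / hs))"
  have rare: "sqrt (g / y) \<le> sqrt (g / x)" if "0 < x" "x \<le> y" for x y
    using that assms by (auto intro!: divide_left_mono)
  have shock: "?s y \<le> ?s x" if "0 < x" "x \<le> y" for x y
    using that assms
    by (intro shock_slope_mono) (auto intro!: divide_left_mono add_pos_pos)
  consider "k \<le> hs" | "h \<le> hs" "hs < k" | "hs < h" by linarith
  then show ?thesis
  proof cases
    case 2
    \<comment> \<open>Depths on opposite sides of \<open>hs\<close> are compared through the common
      slope at \<open>hs\<close>.\<close>
    have "?s k \<le> ?s hs" using 2 assms by (intro shock) auto
    also have "\<dots> \<le> sqrt (g / h)"
      unfolding shock_slope_at_hs[OF assms(1,2)] using 2 assms by (intro rare)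
    finally show ?thesis using 2 by (simp add: depth_part_slope_def)
  qed (use rare shock assms in \<open>auto simp: depth_part_slope_def\<close>)
qed

lemma depth_part_slope_pos:
  assumes "0 < g" "0 < hs" "0 < h"
  shows "0 < depth_part_slope g hs h"
proof -
  define a where "a = 1 / hs"
  define u where "u = sqrt (1 / h + a)"
  have "0 < a" "0 < u" "a < u\<^sup>2"
    using assms by (auto simp: a_def u_def add_pos_pos)
  moreover have "u^3 - a * u + 2 * a\<^sup>2 / u = u * (u\<^sup>2 - a) + 2 * a\<^sup>2 / u"
    by (simp add: algebra_simps power2_eq_square power3_eq_cube)
  ultimately have "0 < shock_slope g a u"
    using assms by (simp add: shock_slope_def add_pos_pos)
  then show ?thesis using assms by (simp add: depth_part_slope_def a_def u_def)
qed

section \<open>Derivative, continuity and growth of a depth part\<close>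

lemma rarefaction_deriv:
  assumes "0 < g" "0 < h"
  shows "((\<lambda>h. 2 * (sqrt (g * h) - sqrt (g * hs))) has_real_derivative sqrt (g / h)) (at h within S)"
proof -
  have "g / sqrt (g * h) = sqrt (g / h)"
    using assms by (simp add: real_sqrt_mult real_sqrt_divide field_simps)
  moreover have "0 < g * h" using assms by simp
  ultimately show ?thesis
    by (auto intro!: derivative_eq_intros simp: inverse_eq_divide)
qed

text \<open>For positive \<open>h\<close> the radicand is \<open>g/2 * (1 / h + a)\<close>.
  Differentiating the product and eliminating \<open>h\<close> by
  \<open>1 / h = u\<^sup>2 - a\<close> leaves a rational function of \<open>u\<close>, which is
  \<open>shock_slope\<close>.\<close>

lemma shock_deriv:
  assumes "0 < g" "0 < hs" "0 < h"
  shows "((\<lambda>h. (h - hs) * sqrt (1/2 * g * ((h + hs) / (h * hs)))) has_real_derivative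
           shock_slope g (1 / hs) (sqrt (1 / h + 1 / hs))) (at h within S)"
proof -
  define a where "a = 1 / hs"
  define u where "u = sqrt (1 / h + a)"
  have a: "0 < a" "hs = 1 / a" using assms by (auto simp: a_def)
  have u: "0 < u" "u\<^sup>2 = 1 / h + a" using assms a by (auto simp: u_def add_pos_pos)
  have u4: "u^4 = (1 / h + a)\<^sup>2" unfolding u(2)[symmetric] by simp
  have "0 < 1 / h + a" using assms a by (simp add: add_pos_pos)
  moreover have "((\<lambda>h. 1 / h + a) has_real_derivative - (1 / h\<^sup>2)) (at h)"
    using assms by (auto intro!: derivative_eq_intros simp: power2_eq_square)
  ultimately have "((\<lambda>h. sqrt (1 / h + a)) has_real_derivative
      inverse u / 2 * - (1 / h\<^sup>2)) (at h)"
    unfolding u_def by (intro DERIV_chain2[OF DERIV_real_sqrt])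
  then have "((\<lambda>h. (h - hs) * sqrt (1 / h + a)) has_real_derivative
      1 * u + inverse u / 2 * - (1 / h\<^sup>2) * (h - hs)) (at h)"
    unfolding u_def by (intro DERIV_mult) (auto intro!: derivative_eq_intros)
  also have "1 * u + inverse u / 2 * - (1 / h\<^sup>2) * (h - hs) = u - (h - hs) / (2 * h\<^sup>2 * u)"
    using u(1) assms(3) by (simp add: divide_simps)
  finally have "((\<lambda>h. sqrt (g/2) * ((h - hs) * sqrt (1 / h + a))) has_real_derivative
      sqrt (g/2) * (u - (h - hs) / (2 * h\<^sup>2 * u))) (at h)"
    by (rule DERIV_cmult)
  also have "u - (h - hs) / (2 * h\<^sup>2 * u) = (u^4 - a * u\<^sup>2 + 2 * a\<^sup>2) / (2 * a * u)"
  proof -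
    have "u - (h - hs) / (2 * h\<^sup>2 * u) = (2 * a * u\<^sup>2 - a * (h - hs) / h\<^sup>2) / (2 * a * u)"
      using u(1) a(1) assms by (simp add: field_simps power2_eq_square)
    also have "2 * a * u\<^sup>2 - a * (h - hs) / h\<^sup>2 = u^4 - a * u\<^sup>2 + 2 * a\<^sup>2"
      unfolding u4 u(2) using assms a
      by (simp add: field_simps power2_eq_square)
    finally show ?thesis .
  qed
  also have "sqrt (g/2) * \<dots> = shock_slope g a u"
    using u(1) a(1)
    by (simp add: shock_slope_def field_simps power2_eq_square power3_eq_cube power4_eq_xxxx)
  finally have der: "((\<lambda>h. sqrt (g/2) * ((h - hs) * sqrt (1 / h + a))) has_real_derivative
      shock_slope g a u) (at h)" .
  have eq: "sqrt (g/2) * ((x - hs) * sqrt (1 / x + a)) =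
      (x - hs) * sqrt (1/2 * g * ((x + hs) / (x * hs)))" if "x \<in> {0<..}" for x
  proof -
    have "1/2 * g * ((x + hs) / (x * hs)) = g/2 * (1 / x + a)"
      using that assms by (simp add: a_def field_simps)
    then show ?thesis by (simp only: real_sqrt_mult mult_ac)
  qed
  have "((\<lambda>h. (h - hs) * sqrt (1/2 * g * ((h + hs) / (h * hs)))) has_real_derivative
      shock_slope g a u) (at h)"
    by (rule has_field_derivative_transform_within_open[OF der, where S = "{0<..}"])
       (use assms(3) in simp, use assms(3) in simp, rule eq)
  then show ?thesis unfolding a_def u_def by (rule has_field_derivative_at_within)
qed

lemma depth_part_deriv:
  assumes "0 < g" "0 < hs" "0 < h"
  shows "(depth_part g hs has_real_derivative depth_part_slope g hs h) (at h)"
proof -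
  let ?R = "\<lambda>h. 2 * (sqrt (g * h) - sqrt (g * hs))"
  let ?S = "\<lambda>h. (h - hs) * sqrt (1/2 * g * ((h + hs) / (h * hs)))"
  consider "h < hs" | "hs < h" | "h = hs" by linarith
  then show ?thesis
  proof cases
    case 1
    then have "(?R has_real_derivative depth_part_slope g hs h) (at h)"
      using rarefaction_deriv[OF assms(1,3)] by (simp add: depth_part_slope_def)
    then show ?thesis
      by (rule has_field_derivative_transform_within_open[where S = "{..<hs}"])
         (use 1 in \<open>auto simp: depth_part_def\<close>)
  next
    case 2
    then have "(?S has_real_derivative depth_part_slope g hs h) (at h)"
      using shock_deriv[OF assms] by (simp add: depth_part_slope_def)
    then show ?thesis
      by (rule has_field_derivative_transform_within_open[where S = "{hs<..}"])
         (use 2 in \<open>auto simp: depth_part_def\<close>)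
  next
    case 3
    \<comment> \<open>At the junction the one-sided derivatives agree and are glued. Both formulas
      vanish at \<open>hs\<close>, so each represents \<open>depth_part\<close> on its closed
      half-line and the radius 1 below is arbitrary.\<close>
    have "(?R has_real_derivative depth_part_slope g hs h) (at h within {..hs})"
      using rarefaction_deriv[OF assms(1,3)] 3 by (simp add: depth_part_slope_def)
    then have "(depth_part g hs has_real_derivative depth_part_slope g hs h) (at h within {..hs})"
      by (rule has_field_derivative_transform_within[where d = 1])
         (auto simp: depth_part_def 3)
    moreover have "(?S has_real_derivative depth_part_slope g hs h) (at h within {hs..})"
      using shock_deriv[OF assms] shock_slope_at_hs[OF assms(1,2)] 3
      by (simp add: depth_part_slope_def)
    then have "(depth_part g hs has_real_derivative depth_part_slope g hs h) (at h within {hs..})"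
      by (rule has_field_derivative_transform_within[where d = 1])
         (auto simp: depth_part_def 3)
    ultimately have "(depth_part g hs has_real_derivative depth_part_slope g hs h)
        (at h within {..hs} \<union> {hs..})"
      by (simp only: has_field_derivative_iff Lim_within_Un)
    moreover have "{..hs} \<union> {hs..} = UNIV" by auto
    ultimately show ?thesis by simp
  qed
qed

lemma continuous_on_depth_part:
  assumes "0 < g" "0 < hs"
  shows "continuous_on {0..} (depth_part g hs)"
proof -
  have "continuous (at h within {0..}) (depth_part g hs)" if "0 \<le> h" for h
  proof (cases "h = 0")
    case True
    \<comment> \<open>At depth 0 the slope is infinite, so continuity comes from the square root
      formula, valid within distance \<open>hs\<close> of 0.\<close>
    have "continuous (at 0 within {0..}) (\<lambda>h. 2 * (sqrt (g * h) - sqrt (g * hs)))"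
      by (intro continuous_intros)
    then have "continuous (at 0 within {0..}) (depth_part g hs)"
      by (rule continuous_transform_within[OF _ \<open>0 < hs\<close>])
         (auto simp: depth_part_def dist_real_def)
    then show ?thesis using True by simp
  next
    case False
    then have "isCont (depth_part g hs) h"
      using DERIV_isCont[OF depth_part_deriv[OF assms]] that by simp
    then show ?thesis by (rule continuous_at_imp_continuous_at_within)
  qed
  then show ?thesis by (simp add: continuous_on_eq_continuous_within)
qed

text \<open>Since \<open>(h + hs) / (h * hs) = 1 / hs + 1 / h\<close>, the square root stays above
  its limit for large \<open>h\<close>. The linear growth yields a depth at which
  \<open>depth_fun\<close> is nonnegative.\<close>

lemma depth_part_ge_linear:
  assumes "0 < g" "0 < hs" "hs \<le> h"
  shows "(h - hs) * sqrt (g / (2 * hs)) \<le> depth_part g hs h"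
proof (cases "h = hs")
  case False
  have "g / (2 * hs) \<le> 1/2 * g * ((h + hs) / (h * hs))"
    using assms by (simp add: field_simps)
  then show ?thesis
    using assms False by (auto simp: depth_part_def intro!: mult_left_mono)
qed (simp add: depth_part_def)

section \<open>Monotonicity, concavity and the root of the depth function\<close>

context
  fixes g hl ul hr ur :: real
  assumes pos: "0 < g" "0 < hl" "0 < hr"
begin

lemma depth_fun_deriv:
  "0 < h \<Longrightarrow> (depth_fun g hl ul hr ur has_real_derivative
      depth_part_slope g hl h + depth_part_slope g hr h) (at h)"
  unfolding depth_fun_def[abs_def]
  by (rule DERIV_cong[OF DERIV_diff[OF DERIV_add[OF DERIV_add[OF
        depth_part_deriv[OF pos(1,2)] depth_part_deriv[OF pos(1,3)]] DERIV_const] DERIV_const]])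
     simp_all

lemma continuous_on_depth_fun: "continuous_on {0..} (depth_fun g hl ul hr ur)"
  unfolding depth_fun_def[abs_def]
  by (intro continuous_on_diff continuous_on_add continuous_on_const
      continuous_on_depth_part pos)

lemma concave_on_depth_fun: "concave_on {0..} (depth_fun g hl ul hr ur)"
  by (rule concave_on_atLeast[OF continuous_on_depth_fun depth_fun_deriv])
    (simp_all add: add_mono depth_part_slope_antimono pos)

lemma depth_fun_strict_mono:
  assumes "0 \<le> x" "x < y"
  shows "depth_fun g hl ul hr ur x < depth_fun g hl ul hr ur y"
proof (rule DERIV_pos_imp_increasing_open[OF assms(2)])
  show "continuous_on {x..y} (depth_fun g hl ul hr ur)"
    by (rule continuous_on_subset[OF continuous_on_depth_fun]) (use assms in auto)
  show "\<exists>D. (depth_fun g hl ul hr ur has_real_derivative D) (at z) \<and> 0 < D"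
    if "x < z" "z < y" for z
    using depth_fun_deriv[of z] depth_part_slope_pos[of g hl z]
      depth_part_slope_pos[of g hr z] pos assms that
    by (intro exI conjI) (assumption | simp)+
qed

lemma depth_fun_nonneg_somewhere: "\<exists>h\<ge>0. 0 \<le> depth_fun g hl ul hr ur h"
proof -
  let ?c = "sqrt (g / (2 * hl))"
  \<comment> \<open>Beyond both given depths neither part is negative, and the added length makes
    the left part alone outweigh the velocity difference.\<close>
  define h where "h = max hl hr + \<bar>ul - ur\<bar> / ?c"
  have c: "0 < ?c" using pos by simp
  have h: "hl \<le> h" "hr \<le> h" "\<bar>ul - ur\<bar> / ?c \<le> h - hl"
    using c by (auto simp: h_def add_increasing2)
  have "\<bar>ul - ur\<bar> \<le> (h - hl) * ?c"
    using h(3) c by (simp add: pos_divide_le_eq)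
  also have "\<dots> \<le> depth_part g hl h" using pos h by (intro depth_part_ge_linear)
  finally have "\<bar>ul - ur\<bar> \<le> depth_part g hl h" .
  moreover have "0 \<le> (h - hr) * sqrt (g / (2 * hr))" using h pos by simp
  then have "0 \<le> depth_part g hr h"
    using depth_part_ge_linear[of g hr h] pos h by linarith
  ultimately have "0 \<le> depth_fun g hl ul hr ur h" unfolding depth_fun_def by linarith
  then show ?thesis using h pos by (intro exI[of _ h]) auto
qed

lemma star_depth_root:
  assumes "depth_fun g hl ul hr ur 0 \<le> 0"
  shows "0 \<le> star_depth g hl ul hr ur"
    and "depth_fun g hl ul hr ur (star_depth g hl ul hr ur) = 0"
proof -
  let ?f = "depth_fun g hl ul hr ur"
  obtain b where b: "0 \<le> b" "0 \<le> ?f b" using depth_fun_nonneg_somewhere by auto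
  have "continuous_on {0..b} ?f"
    by (rule continuous_on_subset[OF continuous_on_depth_fun]) auto
  then obtain r where r: "0 \<le> r" "?f r = 0"
    using IVT'[of ?f 0 0 b] assms b by auto
  \<comment> \<open>Unique existence is what lets the definite description in
    \<open>star_depth\<close> denote the root.\<close>
  have "\<exists>!h. 0 \<le> h \<and> ?f h = 0"
  proof (rule ex1I[of _ r])
    show "h = r" if "0 \<le> h \<and> ?f h = 0" for h
      using that r depth_fun_strict_mono[of h r] depth_fun_strict_mono[of r h]
      by (cases h r rule: linorder_cases) auto
  qed (use r in simp)
  then have "0 \<le> star_depth g hl ul hr ur \<and> ?f (star_depth g hl ul hr ur) = 0"
    unfolding star_depth_def by (rule theI')
  then show "0 \<le> star_depth g hl ul hr ur" "?f (star_depth g hl ul hr ur) = 0" by auto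
qed

end

text \<open>A Newton step is a relation, so existence of an iteration and convergence of every
  iteration are separate claims. From \<open>h0 = 0\<close> with a positive root no step is defined,
  because the one-sided derivative at 0 is infinite; existence is claimed in all other
  cases.\<close>

theorem corollary2p2p1:
  fixes g hl ul hr ur h0 :: real
  assumes "g > 0" and "hl > 0" and "hr > 0"
    and "depth_fun g hl ul hr ur 0 \<le> 0"
    and "0 \<le> h0" and "h0 \<le> star_depth g hl ul hr ur"
  shows "(0 < h0 \<or> star_depth g hl ul hr ur = 0 \<longrightarrow>
            (\<exists>h. newton_iteration_on {0..} (depth_fun g hl ul hr ur) h0 h)) \<and>
         (\<forall>h. newton_iteration_on {0..} (depth_fun g hl ul hr ur) h0 h \<longrightarrow>
            h \<longlonglongrightarrow> star_depth g hl ul hr ur)"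
proof -
  let ?f = "depth_fun g hl ul hr ur" and ?r = "star_depth g hl ul hr ur"
  note root = star_depth_root[OF assms(1-4)]
  note concave = concave_on_depth_fun[OF assms(1-3)]
  have r: "?r \<in> {0..}" "?f ?r = 0" using root by auto
  have neg: "?f x < 0" if "x \<in> {0..}" "x < ?r" for x
    using depth_fun_strict_mono[OF assms(1-3), of x ?r ul ur] that r by simp
  show ?thesis
  proof (intro conjI impI allI)
    assume h0: "0 < h0 \<or> ?r = 0"
    have diff: "\<exists>D. (?f has_real_derivative D) (at x within {0..})"
      if "h0 \<le> x" "x < ?r" for x
    proof -
      \<comment> \<open>If \<open>h0 = 0\<close>, then the root is 0 as well and no \<open>x\<close>
        satisfies \<open>h0 \<le> x < ?r\<close>.\<close>
      have "0 < x" using h0 that assms(5) by auto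
      then show ?thesis
        using has_field_derivative_at_within[OF depth_fun_deriv[OF assms(1-3)]] by blast
    qed
    show "\<exists>h. newton_iteration_on {0..} ?f h0 h"
      using assms(5) by (intro newton_concave_exists[OF concave r neg diff _ assms(6)]) simp_all
  next
    fix h assume "newton_iteration_on {0..} ?f h0 h"
    then show "h \<longlonglongrightarrow> ?r"
      using newton_concave_converges[OF concave continuous_on_depth_fun[OF assms(1-3)] r]
        neg assms(6) by simp
  qed
qed

end
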